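(* Let $n$ be a positive integer. Any Universal Cycle for $3$-subsets of $[n]=\{1,\ldots,n\}$ can be converted into a Universal Cycle for $3$-multisets of $[n]$; in particular, if a Universal Cycle for $3$-subsets of $[n]$ exists, then a Universal Cycle for $3$-multisets of $[n]$ exists.
   Context: A Universal Cycle for $3$-subsets of $[n]$ is a cyclic sequence $a_1\cdots a_k$ of $k=\binom{n}{3}$ entries from $[n]$ such that every $3$-element subset of $[n]$ appears exactly once as the set $\{a_i,a_{i+1},a_{i+2}\}$ of three cyclically consecutive entries (indices modulo $k$). A Universal Cycle for $3$-multisets of $[n]$ is a cyclic sequence $a_1\cdots a_m$ of $m=\binom{n+2}{3}$ entries from $[n]$ such that every $3$-multiset of $[n]$ appears exactly once as the multiset $\{a_i,a_{i+1},a_{i+2}\}$ of three cyclically consecutive entries (indices modulo $m$). *)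

theory Defs
  imports Main "HOL-Library.Multiset"
begin

text \<open>
  A cyclic sequence \<open>a\<^sub>1 \<dots> a\<^sub>k\<close> over \<open>[n]\<close> is represented by the list of its entries, with
  list position \<open>i\<close> holding \<open>a\<close> with index \<open>i + 1\<close>. Since indices are read modulo \<open>k\<close>, a cyclic
  sequence has at least one entry. This matters only for \<open>n \<le> 2\<close>, where \<open>n choose 3 = 0\<close>: the
  empty list does not count as a universal cycle. (If it did, it would be one for the 3-subsets
  of \<open>{1, 2}\<close>, while \<open>{1, 2}\<close> has no universal cycle for 3-multisets.)
\<close>

definition cyclic_seq :: "nat \<Rightarrow> nat \<Rightarrow> nat list \<Rightarrow> bool" where
  "cyclic_seq n k a \<longleftrightarrow> k \<ge> 1 \<and> length a = k \<and> set a \<subseteq> {1..n}"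

definition cyc_nth :: "nat list \<Rightarrow> nat \<Rightarrow> nat" where
  "cyc_nth a i = a ! (i mod length a)"

definition ucycle_3subsets :: "nat \<Rightarrow> nat list \<Rightarrow> bool" where
  "ucycle_3subsets n a \<longleftrightarrow>
     cyclic_seq n (n choose 3) a \<and>
     (\<forall>S. S \<subseteq> {1..n} \<and> card S = 3 \<longrightarrow>
        (\<exists>!i. i < length a \<and> {cyc_nth a i, cyc_nth a (i + 1), cyc_nth a (i + 2)} = S))"

definition ucycle_3multisets :: "nat \<Rightarrow> nat list \<Rightarrow> bool" where
  "ucycle_3multisets n a \<longleftrightarrow>
     cyclic_seq n ((n + 2) choose 3) a \<and>
     (\<forall>M. set_mset M \<subseteq> {1..n} \<and> size M = 3 \<longrightarrow>
        (\<exists>!i. i < length a \<and> {#cyc_nth a i, cyc_nth a (i + 1), cyc_nth a (i + 2)#} = M))"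

end

theory Submission
  imports Defs "Graph_Theory.Euler"
begin

text \<open>
  A cyclic sequence is a closed walk in the digraph whose vertices are ordered pairs and whose arcs
  are triples \<open>(x, y, z)\<close>, leading from \<open>(x, y)\<close> to \<open>(y, z)\<close>. So it suffices to order every
  3-multiset into a triple in such a way that the resulting digraph is balanced and connected, and
  to take an Euler circuit. The 3-subsets keep the order in which the given cycle lists them.
  For the multisets with a repetition, let \<open>D\<close> be an orientation, with equal in- and out-degrees,
  of a graph on \<open>[n]\<close>. If \<open>D x y\<close> then \<open>{x, x, y}\<close> and \<open>{x, y, y}\<close> become \<open>xxy\<close> and \<open>xyy\<close>, a path
  from \<open>(x, x)\<close> through \<open>(x, y)\<close> to \<open>(y, y)\<close>; if \<open>x\<close> and \<open>y\<close> are not joined by \<open>D\<close>, they become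
  \<open>xyx\<close> and \<open>yxy\<close>, a 2-cycle through \<open>(x, y)\<close>.

  For odd \<open>n\<close> we let \<open>D\<close> be a regular tournament. For even \<open>n\<close> it orients the complete graph minus
  a perfect matching; to connect the 2-cycles to the rest, the matched pairs must occur as neighbours
  in the given cycle. Pairs that do not occur form a (partial) matching: if \<open>u\<close> and \<open>v\<close> are never
  neighbours, then \<open>{u, v, x}\<close> is listed with \<open>x\<close> in the middle, so \<open>u\<close> and \<open>x\<close> are neighbours.
  Since \<open>n \<ge> 4\<close>, a perfect matching avoiding them exists.
\<close>

section \<open>Closed walks in digraphs and cyclic sequences\<close>

lemma (in pre_digraph) cas_consecutive:
  assumes "cas u p v" "Suc i < length p"
  shows "head G (p ! i) = tail G (p ! Suc i)"
  using assms
proof (induction p arbitrary: u i)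
  case (Cons e es)
  show ?case
  proof (cases i)
    case 0
    then show ?thesis using Cons.prems by (cases es) auto
  next
    case (Suc j)
    then show ?thesis using Cons by auto
  qed
qed simp

lemma (in pre_digraph) cas_last:
  assumes "cas u p v" "p \<noteq> []"
  shows "head G (last p) = v"
  using assms by (induction p arbitrary: u) auto

text \<open>At the last arc the index wraps to 0: its head is the base point \<open>u\<close>, which
  is also the tail of the first arc.\<close>

lemma (in pre_digraph) cas_closed_consecutive:
  assumes "cas u p u" "i < length p"
  shows "head G (p ! i) = tail G (p ! (Suc i mod length p))"
proof (cases "Suc i < length p")
  case True
  then show ?thesis using cas_consecutive[OF assms(1)] by simp
next
  case False
  then have i: "Suc i = length p" using assms(2) by simp
  then have "p \<noteq> []" by auto
  then have "head G (p ! i) = u"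
    using cas_last[OF assms(1)] last_conv_nth[of p] by (simp flip: i)
  moreover have "tail G (p ! 0) = u"
    using assms(1) \<open>p \<noteq> []\<close> by (cases p) auto
  ultimately show ?thesis using i by simp
qed

definition window :: "nat list \<Rightarrow> nat \<Rightarrow> nat \<times> nat \<times> nat" where
  "window a i = (cyc_nth a i, cyc_nth a (i + 1), cyc_nth a (i + 2))"

text \<open>
  Connectedness of the graph on overlapping pairs is phrased through predicates that are invariant
  along all arcs; this spares the applications any explicit paths.
\<close>

lemma cyclic_sequence_of_balanced_triples:
  fixes T :: "(nat \<times> nat \<times> nat) set"
  assumes fin: "finite T" and ne: "T \<noteq> {}"
    and bal: "\<And>x y. card {z. (x, y, z) \<in> T} = card {w. (w, x, y) \<in> T}"
    and con: "\<And>P x y z x' y' z'. (\<And>x y z. (x, y, z) \<in> T \<Longrightarrow> P x y \<longleftrightarrow> P y z) \<Longrightarrow>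
       (x, y, z) \<in> T \<Longrightarrow> (x', y', z') \<in> T \<Longrightarrow> P x y \<Longrightarrow> P x' y'"
  obtains b where "length b = card T" "bij_betw (window b) {..<length b} T"
proof -
  define tl3 :: "nat \<times> nat \<times> nat \<Rightarrow> nat \<times> nat" where "tl3 t = (fst t, fst (snd t))" for t
  define hd3 :: "nat \<times> nat \<times> nat \<Rightarrow> nat \<times> nat" where "hd3 = snd"
  define G where "G = \<lparr>verts = tl3 ` T \<union> hd3 ` T, arcs = T, tail = tl3, head = hd3\<rparr>"
  interpret fin_digraph G
    by unfold_locales (auto simp: G_def fin)
  have deg: "in_degree G u = out_degree G u" for u
  proof (cases u)
    case (Pair x y)
    have "in_arcs G u = (\<lambda>w. (w, x, y)) ` {w. (w, x, y) \<in> T}"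
      by (auto simp: in_arcs_def G_def hd3_def Pair)
    moreover have "out_arcs G u = (\<lambda>z. (x, y, z)) ` {z. (x, y, z) \<in> T}"
      by (auto simp: out_arcs_def G_def tl3_def Pair)
    ultimately show ?thesis
      unfolding in_degree_def out_degree_def using bal[of x y]
      by (simp add: card_image inj_on_def)
  qed
  have conn: "connected G"
  proof (unfold connected_conv, intro conjI ballI)
    show "verts G \<noteq> {}" using ne by (auto simp: G_def)
  next
    fix u v assume u: "u \<in> verts G" and v: "v \<in> verts G"
    \<comment> \<open>Reachability from \<open>u\<close> in the symmetric closure, read as a
      predicate on pairs, is invariant along every arc, so \<open>con\<close> applies to it.\<close>
    define R where "R = rtrancl_on (verts G) ((arcs_ends G)\<^sup>s)"
    define P where "P x y \<longleftrightarrow> (u, (x, y)) \<in> R" for x y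
    have step: "P x y \<longleftrightarrow> P y z" if t: "(x, y, z) \<in> T" for x y z
    proof -
      have e: "((x, y), (y, z)) \<in> (arcs_ends G)\<^sup>s" "((y, z), (x, y)) \<in> (arcs_ends G)\<^sup>s"
        using t by (force simp: arcs_ends_conv G_def tl3_def hd3_def symcl_def image_iff)+
      have m: "(x, y) \<in> verts G" "(y, z) \<in> verts G"
        using t by (auto simp: G_def tl3_def hd3_def image_iff intro: bexI[OF _ t])
      show ?thesis unfolding P_def R_def
        using e m by (blast intro: rtrancl_on_into_rtrancl_on)
    qed
    have tails: "\<exists>x y z. (x, y, z) \<in> T \<and> (w = (x, y) \<or> w = (y, z))" if "w \<in> verts G" for w
      using that by (force simp: G_def tl3_def hd3_def)
    obtain x y z where t: "(x, y, z) \<in> T" "u = (x, y) \<or> u = (y, z)"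
      using tails[OF u] by blast
    have "(u, u) \<in> R" using u by (simp add: R_def)
    then have "P x y" using t step by (auto simp: P_def)
    obtain x' y' z' where t': "(x', y', z') \<in> T" "v = (x', y') \<or> v = (y', z')"
      using tails[OF v] by blast
    have "P x' y'" by (rule con[OF step t(1) t'(1) \<open>P x y\<close>])
    then show "(u, v) \<in> rtrancl_on (verts G) ((arcs_ends G)\<^sup>s)"
      using t' step[OF t'(1)] by (auto simp: P_def R_def)
  qed
  obtain u p where "euler_trail u p u"
    using closed_euler1[OF conn deg] by blast
  then have cas: "cas u p u" and dist: "distinct p" and set_p: "set p = T"
    by (auto simp: euler_trail_def trail_def awalk_def) (simp_all add: G_def)
  have len: "length p = card T" using dist set_p distinct_card by fastforce
  have pos: "length p > 0" using set_p ne by auto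
  \<comment> \<open>Consecutive arcs overlap in a pair, so the second and third entries of an arc
    are the first entries of its two cyclic successors.\<close>
  define b where "b = map fst p"
  have b: "length b = length p" by (simp add: b_def)
  have cyc: "cyc_nth b i = fst (p ! (i mod length p))" for i
    using pos by (simp add: cyc_nth_def b_def)
  have nxt: "hd3 (p ! (i mod length p)) = tl3 (p ! (Suc i mod length p))" for i
    using cas_closed_consecutive[OF cas, of "i mod length p"] pos
    by (simp add: G_def mod_Suc_eq)
  have w: "window b i = p ! i" if "i < length p" for i
  proof -
    obtain x y z where e: "p ! i = (x, y, z)" by (cases "p ! i")
    obtain x' y' z' where e': "p ! (Suc i mod length p) = (x', y', z')"
      by (cases "p ! (Suc i mod length p)")
    obtain x'' y'' z'' where e'': "p ! (Suc (Suc i) mod length p) = (x'', y'', z'')"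
      by (cases "p ! (Suc (Suc i) mod length p)")
    show ?thesis
      using nxt[of i] nxt[of "Suc i"] e e' e'' that
      by (simp add: window_def cyc hd3_def tl3_def)
  qed
  have "bij_betw ((!) p) {..<length p} T"
    using bij_betw_nth[OF dist] set_p by auto
  then have "bij_betw (window b) {..<length p} T"
    by (rule bij_betw_cong[THEN iffD1, rotated]) (simp add: w)
  then show thesis using that[of b] b len by simp
qed

section \<open>Balanced orientations and matchings\<close>

text \<open>Meant for an involution that exchanges the out-neighbours and the in-neighbours of a
  fixed vertex.\<close>

lemma card_eq_by_involution:
  assumes "\<And>y. y \<in> A \<Longrightarrow> g y \<in> B" "\<And>y. y \<in> B \<Longrightarrow> g y \<in> A"
    "\<And>y. y \<in> A \<union> B \<Longrightarrow> g (g y) = y"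
  shows "card A = card B"
  by (rule bij_betw_same_card[of g], rule bij_betw_byWitness[where f' = g])
    (use assms in auto)

definition balanced_orientation :: "nat set \<Rightarrow> (nat \<Rightarrow> nat \<Rightarrow> bool) \<Rightarrow> bool" where
  "balanced_orientation V D \<longleftrightarrow>
     (\<forall>x y. D x y \<longrightarrow> x \<in> V \<and> y \<in> V \<and> x \<noteq> y \<and> \<not> D y x) \<and>
     (\<forall>x. card {y. D x y} = card {y. D y x})"

lemma balanced_orientation_converse:
  "balanced_orientation V D \<Longrightarrow> balanced_orientation V (\<lambda>x y. D y x)"
  unfolding balanced_orientation_def by auto

text \<open>Let \<open>x\<close> beat \<open>y\<close> when the residue of \<open>y - x\<close>
  modulo \<open>n\<close> is odd. As \<open>n\<close> is odd, the nonzero residues \<open>d\<close>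
  and \<open>n - d\<close> differ in parity, so exactly one direction holds. Reflection in
  \<open>x\<close> negates differences from \<open>x\<close> and so swaps its out- and
  in-neighbours.\<close>

lemma odd_rotational_tournament:
  assumes "odd n"
  shows "\<exists>D. balanced_orientation {1..n} D \<and> (\<forall>x\<in>{1..n}. \<forall>y\<in>{1..n}. x \<noteq> y \<longrightarrow> D x y \<or> D y x)"
proof -
  define D where "D x y \<longleftrightarrow> x \<in> {1..n} \<and> y \<in> {1..n} \<and> odd ((int y - int x) mod int n)" for x y
  have npos: "n > 0" using assms by (cases n) auto
  have rev: "odd ((int y - int x) mod int n) \<longleftrightarrow> \<not> odd ((int x - int y) mod int n)"
    if "x \<in> {1..n}" "y \<in> {1..n}" "x \<noteq> y" for x y
  proof -
    have "(int y - int x) mod int n \<noteq> 0"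
    proof
      assume "(int y - int x) mod int n = 0"
      then have "int n dvd int y - int x" by (simp add: mod_eq_0_iff_dvd)
      then have "int n \<le> \<bar>int y - int x\<bar>"
        using that(3) by (intro zdvd_imp_le) auto
      then show False using that by auto
    qed
    then have "(int x - int y) mod int n = int n - (int y - int x) mod int n"
      using zmod_zminus1_eq_if[of "int y - int x" "int n"] by simp
    then show ?thesis using assms by simp
  qed
  have bal: "card {y. D x y} = card {y. D y x}" for x
  proof -
    \<comment> \<open>The reflection of \<open>y\<close> to \<open>2 * x - y\<close>; subtracting 1
      before the reduction and adding it afterwards selects representatives in \<open>{1..n}\<close>
      instead of \<open>{0..<n}\<close>.\<close>
    define g where "g y = nat ((2 * int x - int y - 1) mod int n) + 1" for y
    have g: "int (g y) = (2 * int x - int y - 1) mod int n + 1" for y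
      using npos by (simp add: g_def)
    have g_in: "g y \<in> {1..n}" for y
    proof -
      have "int (g y) \<le> int n" "int (g y) \<ge> 1"
        unfolding g using npos by (simp_all add: add1_zle_eq)
      then show ?thesis by simp
    qed
    have 1: "(int (g y) - int x) mod int n = (int x - int y) mod int n" for y
    proof -
      have "(int (g y) - int x) mod int n = ((2 * int x - int y - 1) mod int n + (1 - int x)) mod int n"
        unfolding g by (simp add: algebra_simps)
      also have "\<dots> = (2 * int x - int y - 1 + (1 - int x)) mod int n"
        by (rule mod_add_left_eq)
      finally show ?thesis by simp
    qed
    have 2: "(int x - int (g y)) mod int n = (int y - int x) mod int n" for y
      using mod_minus_cong[OF 1[of y]] by simp
    have 3: "g (g y) = y" if "y \<in> {1..n}" for y
    proof -
      have "int (g (g y)) = (2 * int x - 1 - int (g y)) mod int n + 1"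
        unfolding g[of "g y"] by (simp add: algebra_simps)
      also have "\<dots> = (2 * int x - 2 - (2 * int x - int y - 1) mod int n) mod int n + 1"
        unfolding g[of y] by (simp add: algebra_simps)
      also have "\<dots> = (2 * int x - 2 - (2 * int x - int y - 1)) mod int n + 1"
        by (simp only: mod_diff_right_eq)
      also have "\<dots> = (int y - 1) mod int n + 1" by simp
      also have "\<dots> = int y" using that by simp
      finally show ?thesis by simp
    qed
    show ?thesis
      by (rule card_eq_by_involution[where g = g])
        (use g_in 1 2 3 in \<open>auto simp: D_def\<close>)
  qed
  have "x \<in> {1..n} \<and> y \<in> {1..n} \<and> x \<noteq> y \<and> \<not> D y x" if "D x y" for x y
    using that rev[of x y] by (cases "x = y") (auto simp: D_def)
  moreover have "D x y \<or> D y x" if "x \<in> {1..n}" "y \<in> {1..n}" "x \<noteq> y" for x y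
    using that rev[of x y] by (auto simp: D_def)
  ultimately show ?thesis
    unfolding balanced_orientation_def using bal by (intro exI[of _ D]) blast
qed

text \<open>\<open>r\<close> names the matched pair of a vertex and \<open>c\<close> marks its
  smaller element. Passing from \<open>y\<close> to \<open>s y\<close> keeps \<open>r\<close> and
  flips \<open>c\<close>, which reverses the arc to \<open>x\<close>; hence \<open>s\<close> swaps
  the out- and in-neighbours of \<open>x\<close>.\<close>

lemma balanced_orientation_off_matching:
  fixes V :: "nat set" and s :: "nat \<Rightarrow> nat"
  assumes s: "\<And>v. v \<in> V \<Longrightarrow> s v \<in> V \<and> s v \<noteq> v \<and> s (s v) = v"
  shows "\<exists>D. balanced_orientation V D \<and> (\<forall>x\<in>V. \<forall>y\<in>V. x \<noteq> y \<longrightarrow> D x y \<or> D y x \<or> y = s x)"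
proof -
  define r where "r v = min v (s v)" for v
  define c where "c v \<longleftrightarrow> v < s v" for v
  \<comment> \<open>Two matched pairs \<open>{p, s p}\<close> and \<open>{q, s q}\<close> with \<open>p\<close> the least of the four and \<open>q < s q\<close>
    are joined by the directed 4-cycle \<open>p, q, s p, s q\<close>.\<close>
  define D where "D x y \<longleftrightarrow> x \<in> V \<and> y \<in> V \<and> y \<noteq> x \<and> y \<noteq> s x \<and> (r x < r y \<longleftrightarrow> (c x \<longleftrightarrow> c y))" for x y
  have r_ne: "r x \<noteq> r y" if "x \<in> V" "y \<in> V" "y \<noteq> x" "y \<noteq> s x" for x y
    using that s[of x] s[of y] by (auto simp: r_def min_def split: if_splits)
  have rs: "r (s x) = r x" "c (s x) \<longleftrightarrow> \<not> c x" if "x \<in> V" for x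
    using s[OF that] by (auto simp: r_def c_def min_def)
  have D_s: "D x (s y)" if "D y x" for x y
    using that r_ne[of y x] rs[of y] s[of y] s[of x] by (auto simp: D_def)
  have D_s': "D (s y) x" if "D x y" for x y
    using that r_ne[of x y] rs[of y] s[of y] s[of x] by (auto simp: D_def)
  have bal: "card {y. D x y} = card {y. D y x}" for x
    by (rule card_eq_by_involution[where g = s]) (use D_s D_s' s in \<open>auto simp: D_def\<close>)
  have "x \<in> V \<and> y \<in> V \<and> x \<noteq> y \<and> \<not> D y x" if "D x y" for x y
    using that r_ne[of x y] by (auto simp: D_def)
  moreover have "D x y \<or> D y x \<or> y = s x" if "x \<in> V" "y \<in> V" "x \<noteq> y" for x y
    using that r_ne[of x y] s[of x] s[of y] by (auto simp: D_def)
  ultimately show ?thesis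
    unfolding balanced_orientation_def using bal by (intro exI[of _ D]) blast
qed

text \<open>Each vertex has at most one forbidden partner, so of two candidates one is allowed;
  match it and remove both vertices. The induction stops at four vertices: if \<open>A\<close> meets
  the matching \<open>ab\<close>, \<open>cd\<close>, then it misses \<open>ac\<close>,
  \<open>bd\<close>. Two vertices would not do, as their only matching may be forbidden.\<close>

lemma perfect_matching_avoiding_matching:
  assumes "finite V" "even (card V)" "card V \<ge> 4"
    and sym: "\<And>u v. A u v \<Longrightarrow> A v u" and deg: "\<And>u v w. A u v \<Longrightarrow> A u w \<Longrightarrow> v = w"
  shows "\<exists>s. \<forall>v\<in>V. s v \<in> V \<and> s v \<noteq> v \<and> s (s v) = v \<and> \<not> A v (s v)"
proof -
  have "card V = 2 * (card V div 2 - 2) + 4" using assms(2,3) by presburger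
  then obtain m where "card V = 2 * m + 4" ..
  with \<open>finite V\<close> show ?thesis
  proof (induction m arbitrary: V)
    case 0
    then obtain a b c d where V: "V = {a, b, c, d}" "distinct [a, b, c, d]"
      by (auto simp: card_Suc_eq eval_nat_numeral)
    show ?case
    proof (cases "A a b \<or> A c d")
      case False
      then have "\<not> A a b" "\<not> A b a" "\<not> A c d" "\<not> A d c" by (blast dest: sym)+
      then show ?thesis using V
        by (intro exI[of _ "id(a := b, b := a, c := d, d := c)"]) auto
    next
      case True
      have "a \<noteq> d" "b \<noteq> c" using V by auto
      with True have "\<not> A a c" "\<not> A b d" by (blast dest: deg sym)+
      moreover from this have "\<not> A c a" "\<not> A d b" by (blast dest: sym)+
      ultimately show ?thesis using V
        by (intro exI[of _ "id(a := c, c := a, b := d, d := b)"]) auto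
    qed
  next
    case (Suc m)
    from Suc.prems obtain a b c where abc: "{a, b, c} \<subseteq> V" "distinct [a, b, c]"
      by (auto simp: card_Suc_eq eval_nat_numeral)
    obtain d where d: "d \<in> V" "d \<noteq> a" "\<not> A a d"
      using abc deg[of a b c] by auto
    then have "\<not> A d a" by (blast dest: sym)
    have "card (V - {a, d}) = 2 * m + 4"
      using Suc.prems d abc by (simp add: card_Diff_subset)
    then obtain s where s: "\<forall>v\<in>V - {a, d}. s v \<in> V - {a, d} \<and> s v \<noteq> v \<and> s (s v) = v \<and> \<not> A v (s v)"
      using Suc.IH[of "V - {a, d}"] Suc.prems by auto
    show ?case
      using s d abc \<open>\<not> A d a\<close> by (intro exI[of _ "s(a := d, d := a)"]) auto
  qed
qed

section \<open>Windows of a universal cycle for 3-subsets\<close>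

lemma cyc_nth_mod: "cyc_nth a (i mod length a + j) = cyc_nth a (i + j)"
  by (simp add: cyc_nth_def mod_add_left_eq)

lemma window_mod: "window a (i mod length a) = window a i"
  using cyc_nth_mod[of a i 0] cyc_nth_mod[of a i 1] cyc_nth_mod[of a i 2]
  by (simp add: window_def)

context
  fixes n :: nat and a :: "nat list"
  assumes U: "ucycle_3subsets n a"
begin

lemma length_ucycle: "length a = n choose 3" "length a > 0"
  using U unfolding ucycle_3subsets_def cyclic_seq_def by linarith+

lemma cyc_nth_ucycle: "cyc_nth a i \<in> {1..n}"
proof -
  have "cyc_nth a i \<in> set a" using length_ucycle(2) by (simp add: cyc_nth_def)
  then show ?thesis using U unfolding ucycle_3subsets_def cyclic_seq_def by blast
qed

text \<open>The definition does not say that each window has three distinct entries. This follows by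
  counting: \<open>n choose 3\<close> windows cover \<open>n choose 3\<close> subsets, so none is
  wasted.\<close>

lemma bij_betw_window_sets:
  "bij_betw (\<lambda>i. {cyc_nth a i, cyc_nth a (i + 1), cyc_nth a (i + 2)}) {..<length a}
     {S. S \<subseteq> {1..n} \<and> card S = 3}"
proof -
  let ?F = "\<lambda>i. {cyc_nth a i, cyc_nth a (i + 1), cyc_nth a (i + 2)}"
  let ?S = "{S. S \<subseteq> {1..n} \<and> card S = 3}"
  have card: "card ?S = length a"
    using n_subsets[of "{1..n}" 3] length_ucycle by simp
  have "?S \<subseteq> ?F ` {..<length a}"
  proof
    fix S assume "S \<in> ?S"
    then obtain i where "i < length a" "?F i = S"
      using U unfolding ucycle_3subsets_def by blast
    then show "S \<in> ?F ` {..<length a}" by blast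
  qed
  moreover have "card (?F ` {..<length a}) \<le> card ?S"
    using card_image_le[of "{..<length a}" ?F] card by simp
  ultimately have img: "?F ` {..<length a} = ?S"
    by (intro card_seteq[symmetric]) auto
  then have "inj_on ?F {..<length a}"
    by (intro eq_card_imp_inj_on) (simp_all only: card finite_lessThan card_lessThan)
  with img show ?thesis by (simp add: bij_betw_def)
qed

lemma distinct_window: "distinct [cyc_nth a i, cyc_nth a (i + 1), cyc_nth a (i + 2)]"
proof -
  let ?j = "i mod length a"
  have "?j < length a" using length_ucycle by simp
  then have "card {cyc_nth a ?j, cyc_nth a (?j + 1), cyc_nth a (?j + 2)} = 3"
    using bij_betwE[OF bij_betw_window_sets] by blast
  then have "card {cyc_nth a i, cyc_nth a (i + 1), cyc_nth a (i + 2)} = 3"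
    using cyc_nth_mod[of a i 0] cyc_nth_mod[of a i 1] cyc_nth_mod[of a i 2] by simp
  then show ?thesis by (auto simp: card_insert_if split: if_splits)
qed

text \<open>For \<open>n < 3\<close> the length would be 0, which \<open>cyclic_seq\<close>
  excludes; for \<open>n = 3\<close> it would be 1, and a single entry read cyclically gives a
  constant window.\<close>

lemma ucycle_size_ge_4: "n \<ge> 4"
proof (rule ccontr)
  assume "\<not> n \<ge> 4"
  moreover have "n \<ge> 3" using length_ucycle by (cases "n < 3") auto
  ultimately have "n = 3" by simp
  then have "length a = 1" using length_ucycle by simp
  then show False using distinct_window[of 0] by (simp add: cyc_nth_def)
qed

text \<open>In the window that lists \<open>{u, v, w}\<close> only the two outer entries are not
  consecutive, so at most one of its pairs is never adjacent.\<close>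

lemma nonadjacent_unique:
  assumes "u \<in> {1..n}" "v \<in> {1..n}" "w \<in> {1..n}" "u \<noteq> v" "u \<noteq> w"
    and v: "\<nexists>i. {cyc_nth a i, cyc_nth a (i + 1)} = {u, v}"
    and w: "\<nexists>i. {cyc_nth a i, cyc_nth a (i + 1)} = {u, w}"
  shows "v = w"
proof (rule ccontr)
  assume "v \<noteq> w"
  then have "{u, v, w} \<in> {S. S \<subseteq> {1..n} \<and> card S = 3}" using assms(1-5) by simp
  then obtain i where i: "{u, v, w} = {cyc_nth a i, cyc_nth a (i + 1), cyc_nth a (i + 2)}"
    unfolding bij_betw_imp_surj_on[OF bij_betw_window_sets, symmetric] by (elim imageE)
  define p q r where "p = cyc_nth a i" "q = cyc_nth a (i + 1)" "r = cyc_nth a (i + 2)"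
  note pqr = p_q_r_def
  have nb: "{p, q} \<noteq> {u, v}" "{p, q} \<noteq> {u, w}" "{q, r} \<noteq> {u, v}" "{q, r} \<noteq> {u, w}"
    using v[simplified not_ex, rule_format, of i] w[simplified not_ex, rule_format, of i]
      v[simplified not_ex, rule_format, of "i + 1"] w[simplified not_ex, rule_format, of "i + 1"]
    by (simp_all add: pqr)
  have "p \<noteq> q" "q \<noteq> r" "p \<noteq> r" using distinct_window[of i] by (simp_all add: pqr)
  moreover have "u \<in> {p, q, r}" "p \<in> {u, v, w}" "q \<in> {u, v, w}" "r \<in> {u, v, w}"
    using i by (auto simp: pqr)
  ultimately show False using nb by (auto simp: doubleton_eq_iff)
qed

text \<open>The last three conclusions serve connectedness: unjoined pairs occur in the sequence, no
  vertex is unjoined to two others, and some arc of \<open>D\<close> runs along the sequence, which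
  will link the diagonal pairs \<open>(x, x)\<close> to the windows.\<close>

lemma balanced_orientation_ucycle:
  obtains D i
  where "balanced_orientation {1..n} D"
    "\<forall>x\<in>{1..n}. \<forall>y\<in>{1..n}. x \<noteq> y \<longrightarrow> \<not> D x y \<longrightarrow> \<not> D y x \<longrightarrow>
       (\<exists>i. {cyc_nth a i, cyc_nth a (i + 1)} = {x, y})"
    "\<forall>x\<in>{1..n}. \<forall>y\<in>{1..n}. \<forall>z\<in>{1..n}. x \<noteq> y \<longrightarrow> x \<noteq> z \<longrightarrow> y \<noteq> z \<longrightarrow>
       D x y \<or> D y x \<or> D x z \<or> D z x"
    "D (cyc_nth a i) (cyc_nth a (i + 1))"
proof -
  define adj where "adj x y \<longleftrightarrow> (\<exists>i. {cyc_nth a i, cyc_nth a (i + 1)} = {x, y})" for x y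
  define good where "good D \<longleftrightarrow> balanced_orientation {1..n} D \<and>
    (\<forall>x\<in>{1..n}. \<forall>y\<in>{1..n}. x \<noteq> y \<longrightarrow> \<not> D x y \<longrightarrow> \<not> D y x \<longrightarrow> adj x y) \<and>
    (\<forall>x\<in>{1..n}. \<forall>y\<in>{1..n}. \<forall>z\<in>{1..n}. x \<noteq> y \<longrightarrow> x \<noteq> z \<longrightarrow> y \<noteq> z \<longrightarrow>
       D x y \<or> D y x \<or> D x z \<or> D z x)" for D
  have "\<exists>D. good D"
  proof (cases "odd n")
    case True
    then show ?thesis using odd_rotational_tournament[OF True] unfolding good_def by blast
  next
    case False
    define A where "A u v \<longleftrightarrow> u \<in> {1..n} \<and> v \<in> {1..n} \<and> u \<noteq> v \<and> \<not> adj u v" for u v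
    have "A v u" if "A u v" for u v using that by (auto simp: A_def adj_def insert_commute)
    moreover have "v = w" if "A u v" "A u w" for u v w
      using that nonadjacent_unique[of u v w] unfolding A_def adj_def by blast
    ultimately obtain s
      where s: "\<forall>v\<in>{1..n}. s v \<in> {1..n} \<and> s v \<noteq> v \<and> s (s v) = v \<and> \<not> A v (s v)"
      using perfect_matching_avoiding_matching[of "{1..n}" A] False ucycle_size_ge_4 by auto
    then obtain D where D: "balanced_orientation {1..n} D"
      and ds: "\<forall>x\<in>{1..n}. \<forall>y\<in>{1..n}. x \<noteq> y \<longrightarrow> D x y \<or> D y x \<or> y = s x"
      using balanced_orientation_off_matching[of "{1..n}" s] by blast
    have "adj x y" if "x \<in> {1..n}" "y \<in> {1..n}" "x \<noteq> y" "\<not> D x y" "\<not> D y x" for x y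
    proof -
      have "y = s x" using ds that by blast
      then have "\<not> A x y" using s that by blast
      then show ?thesis using that unfolding A_def by blast
    qed
    moreover have "D x y \<or> D y x \<or> D x z \<or> D z x"
      if "x \<in> {1..n}" "y \<in> {1..n}" "z \<in> {1..n}" "x \<noteq> y" "x \<noteq> z" "y \<noteq> z" for x y z
      using ds that by metis
    ultimately show ?thesis using D unfolding good_def by blast
  qed
  then obtain D where D: "good D" ..
  have good_converse: "good (\<lambda>x y. D y x)"
    using D balanced_orientation_converse[of "{1..n}" D] unfolding good_def by blast
  \<comment> \<open>The entry at 1 is joined to at least one of its two neighbours; should the arc
    point backwards, the converse of \<open>D\<close> is taken.\<close>
  have "cyc_nth a 1 \<noteq> cyc_nth a 0" "cyc_nth a 1 \<noteq> cyc_nth a 2" "cyc_nth a 0 \<noteq> cyc_nth a 2"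
    using distinct_window[of 0] by (auto simp: numeral_2_eq_2)
  then have "D (cyc_nth a 1) (cyc_nth a 0) \<or> D (cyc_nth a 0) (cyc_nth a 1) \<or>
      D (cyc_nth a 1) (cyc_nth a 2) \<or> D (cyc_nth a 2) (cyc_nth a 1)"
    using D cyc_nth_ucycle unfolding good_def by blast
  then have "\<exists>i. D (cyc_nth a i) (cyc_nth a (i + 1)) \<or> D (cyc_nth a (i + 1)) (cyc_nth a i)"
    by (metis add_0 one_add_one)
  then obtain i where "D (cyc_nth a i) (cyc_nth a (i + 1)) \<or> D (cyc_nth a (i + 1)) (cyc_nth a i)" ..
  then show thesis
    using that[of D i] that[of "\<lambda>x y. D y x" i] D good_converse
    unfolding good_def adj_def by blast
qed

lemma inj_on_window: "inj_on (window a) {..<length a}"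
proof (rule inj_onI)
  fix i j assume "i \<in> {..<length a}" "j \<in> {..<length a}" "window a i = window a j"
  then show "i = j"
    using inj_onD[OF bij_betw_imp_inj_on[OF bij_betw_window_sets], of i j]
    by (simp add: window_def)
qed

text \<open>A window starts with \<open>(x, y)\<close> exactly when the window one position earlier
  ends with it, so the cyclic shift of positions matches the two sets.\<close>

lemma balanced_windows:
  "card {z. (x, y, z) \<in> window a ` {..<length a}} = card {w. (w, x, y) \<in> window a ` {..<length a}}"
proof -
  let ?W = "window a ` {..<length a}" and ?f = "cyc_nth a"
  define I where "I = {i \<in> {..<length a}. ?f i = x \<and> ?f (i + 1) = y}"
  define J where "J = {i \<in> {..<length a}. ?f (i + 1) = x \<and> ?f (i + 2) = y}"
  have "bij_betw (\<lambda>z. (x, y, z)) {z. (x, y, z) \<in> ?W} (window a ` I)"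
    by (auto simp: bij_betw_def inj_on_def I_def window_def image_iff)
  then have "card {z. (x, y, z) \<in> ?W} = card (window a ` I)"
    by (rule bij_betw_same_card)
  also have "\<dots> = card I"
    by (rule card_image, rule inj_on_subset[OF inj_on_window]) (auto simp: I_def)
  also have "card I = card J"
  proof (rule bij_betw_same_card[symmetric], rule bij_betw_imageI)
    let ?h = "\<lambda>i. Suc i mod length a"
    show "inj_on ?h J"
      by (auto simp: inj_on_def J_def mod_Suc split: if_splits)
    have shift: "?f (?h i) = ?f (i + 1)" "?f (?h i + 1) = ?f (i + 2)" for i
      using cyc_nth_mod[of a "Suc i" 0] cyc_nth_mod[of a "Suc i" 1] by simp_all
    show "?h ` J = I"
    proof
      show "?h ` J \<subseteq> I" using shift length_ucycle by (auto simp: I_def J_def)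
      show "I \<subseteq> ?h ` J"
      proof
        fix i assume i: "i \<in> I"
        \<comment> \<open>The cyclic predecessor of \<open>i\<close>, written so that no truncated
          subtraction occurs at \<open>i = 0\<close>.\<close>
        define j where "j = (i + (length a - 1)) mod length a"
        have j: "j < length a" "?h j = i"
          using i length_ucycle(2) by (auto simp: j_def I_def mod_Suc_eq)
        then have "j \<in> J" using i shift[of j] by (auto simp: I_def J_def)
        then show "i \<in> ?h ` J" using j by blast
      qed
    qed
  qed
  also have "card J = card (window a ` J)"
    by (rule card_image[symmetric], rule inj_on_subset[OF inj_on_window]) (auto simp: J_def)
  also have "bij_betw (\<lambda>w. (w, x, y)) {w. (w, x, y) \<in> ?W} (window a ` J)"
    by (auto simp: bij_betw_def inj_on_def J_def window_def image_iff)
  then have "card (window a ` J) = card {w. (w, x, y) \<in> ?W}"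
    by (rule bij_betw_same_card[symmetric])
  finally show ?thesis .
qed

end

section \<open>Triples for the multisets with a repetition\<close>

text \<open>The pair \<open>(x, y)\<close> encodes the multiset \<open>{#x, x, y#}\<close>; for
  \<open>x = y\<close> every branch gives \<open>(x, x, x)\<close>.\<close>

definition repeat_triple :: "(nat \<Rightarrow> nat \<Rightarrow> bool) \<Rightarrow> nat \<times> nat \<Rightarrow> nat \<times> nat \<times> nat" where
  "repeat_triple D = (\<lambda>(x, y). if D x y then (x, x, y) else if D y x then (y, x, x) else (x, y, x))"

text \<open>The loops \<open>(x, x, x)\<close> fall under the third disjunct.\<close>

lemma repeat_triples_iff:
  assumes "balanced_orientation V D"
  shows "(x, y, z) \<in> repeat_triple D ` (V \<times> V) \<longleftrightarrow>
    (x = y \<and> D y z) \<or> (D x y \<and> y = z) \<or> (x = z \<and> x \<in> V \<and> y \<in> V \<and> \<not> D x y \<and> \<not> D y x)"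
    (is "?L \<longleftrightarrow> ?R")
proof
  show "?L \<Longrightarrow> ?R" by (auto simp: repeat_triple_def split: if_splits)
  have D: "u \<in> V \<and> v \<in> V \<and> \<not> D v u" if "D u v" for u v
    using assms that unfolding balanced_orientation_def by blast
  assume ?R
  then consider "x = y" "D y z" | "D x y" "y = z" | "x = z" "x \<in> V" "y \<in> V" "\<not> D x y" "\<not> D y x"
    by blast
  then show ?L
  proof cases
    case 1
    then show ?thesis using D by (intro image_eqI[of _ _ "(y, z)"]) (auto simp: repeat_triple_def)
  next
    case 2
    then show ?thesis using D by (intro image_eqI[of _ _ "(y, x)"]) (auto simp: repeat_triple_def)
  next
    case 3
    then show ?thesis by (intro image_eqI[of _ _ "(x, y)"]) (auto simp: repeat_triple_def)
  qed
qed

text \<open>Only the diagonal needs the balance of \<open>D\<close>: at \<open>(x, x)\<close> there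
  is a loop, one arc out per out-neighbour and one in per in-neighbour. Elsewhere both degrees are
  1, or both are 0.\<close>

lemma balanced_repeat_triples:
  assumes "finite V" and bo: "balanced_orientation V D"
  shows "card {z. (x, y, z) \<in> repeat_triple D ` (V \<times> V)} =
    card {w. (w, x, y) \<in> repeat_triple D ` (V \<times> V)}"
proof -
  have D: "u \<in> V \<and> v \<in> V \<and> u \<noteq> v \<and> \<not> D v u" if "D u v" for u v
    using bo that unfolding balanced_orientation_def by blast
  note mem = repeat_triples_iff[OF bo]
  consider "x = y" "x \<in> V" | "D x y" | "D y x" | "x \<noteq> y" "\<not> D x y" "\<not> D y x" "x \<in> V" "y \<in> V"
    | "x \<notin> V \<or> y \<notin> V"
    using D by blast
  then show ?thesis
  proof cases
    case 1
    have "{z. (x, y, z) \<in> repeat_triple D ` (V \<times> V)} = insert x {z. D x z}"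
      "{w. (w, x, y) \<in> repeat_triple D ` (V \<times> V)} = insert x {w. D w x}"
      unfolding mem using 1 D by blast+
    moreover have "finite {z. D x z}" "finite {w. D w x}"
      by (rule finite_subset[OF _ \<open>finite V\<close>]; use D in blast)+
    moreover have "\<not> D x x" using D by blast
    moreover have "card {z. D x z} = card {w. D w x}"
      using bo unfolding balanced_orientation_def by blast
    ultimately show ?thesis by simp
  next
    case 2
    have "{z. (x, y, z) \<in> repeat_triple D ` (V \<times> V)} = {y}"
      "{w. (w, x, y) \<in> repeat_triple D ` (V \<times> V)} = {x}"
      unfolding mem using 2 D by blast+
    then show ?thesis by simp
  next
    case 3
    have "{z. (x, y, z) \<in> repeat_triple D ` (V \<times> V)} = {}"
      "{w. (w, x, y) \<in> repeat_triple D ` (V \<times> V)} = {}"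
      unfolding mem using 3 D by blast+
    then show ?thesis by simp
  next
    case 4
    have "{z. (x, y, z) \<in> repeat_triple D ` (V \<times> V)} = {x}"
      "{w. (w, x, y) \<in> repeat_triple D ` (V \<times> V)} = {y}"
      unfolding mem using 4 D by blast+
    then show ?thesis by simp
  next
    case 5
    have "{z. (x, y, z) \<in> repeat_triple D ` (V \<times> V)} = {}"
      "{w. (w, x, y) \<in> repeat_triple D ` (V \<times> V)} = {}"
      unfolding mem using 5 D by blast+
    then show ?thesis by simp
  qed
qed

section \<open>From triples back to multisets\<close>

definition mset3 :: "nat \<times> nat \<times> nat \<Rightarrow> nat multiset" where
  "mset3 = (\<lambda>(x, y, z). {#x, y, z#})"

lemma size_3E:
  assumes "size M = 3"
  obtains x y z where "M = {#x, y, z#}"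
proof -
  obtain x N where N: "M = add_mset x N"
    using assms size_eq_Suc_imp_eq_union[of M 2] by auto
  then obtain y K where K: "N = add_mset y K"
    using assms size_eq_Suc_imp_eq_union[of N 1] by auto
  then obtain z where "K = {#z#}"
    using N assms size_1_singleton_mset[of K] by auto
  with N K show thesis using that by simp
qed

text \<open>A 3-multiset with a repetition is determined by its repeated element and the remaining
  one.\<close>

lemma bij_betw_repeat_msets:
  "bij_betw (\<lambda>(x, y). {#x, x, y#}) (V \<times> V)
     {M. set_mset M \<subseteq> V \<and> size M = 3 \<and> card (set_mset M) \<noteq> 3}"
proof (rule bij_betw_imageI)
  show "inj_on (\<lambda>(x, y). {#x, x, y#}) (V \<times> V)"
    by (auto simp: inj_on_def add_eq_conv_ex)
  show "(\<lambda>(x, y). {#x, x, y#}) ` (V \<times> V) =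
      {M. set_mset M \<subseteq> V \<and> size M = 3 \<and> card (set_mset M) \<noteq> 3}"
  proof (intro equalityI subsetI)
    fix M assume "M \<in> {M. set_mset M \<subseteq> V \<and> size M = 3 \<and> card (set_mset M) \<noteq> 3}"
    then have M: "set_mset M \<subseteq> V" "size M = 3" "card (set_mset M) \<noteq> 3" by auto
    obtain x y z where xyz: "M = {#x, y, z#}" using M(2) by (rule size_3E)
    then have "x = y \<or> x = z \<or> y = z" using M(3) by (cases "x = y"; cases "x = z"; cases "y = z") auto
    then consider "M = {#x, x, z#}" | "M = {#x, x, y#}" | "M = {#y, y, x#}"
      using xyz by (auto simp: add_mset_commute)
    then show "M \<in> (\<lambda>(x, y). {#x, x, y#}) ` (V \<times> V)"
      using M(1) xyz by cases (force simp: image_iff)+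
  qed (auto simp: card_insert_if split: if_splits)
qed

lemma mset3_repeat_triple: "mset3 (repeat_triple D p) = (case p of (x, y) \<Rightarrow> {#x, x, y#})"
  by (auto simp: mset3_def repeat_triple_def add_mset_commute split: prod.splits)

lemma bij_betw_mset3_repeat_triples:
  "bij_betw mset3 (repeat_triple D ` (V \<times> V))
     {M. set_mset M \<subseteq> V \<and> size M = 3 \<and> card (set_mset M) \<noteq> 3}"
  and inj_on_repeat_triple: "inj_on (repeat_triple D) (V \<times> V)"
proof -
  have b: "bij_betw (mset3 \<circ> repeat_triple D) (V \<times> V)
      {M. set_mset M \<subseteq> V \<and> size M = 3 \<and> card (set_mset M) \<noteq> 3}"
    using bij_betw_repeat_msets[of V] by (simp add: comp_def mset3_repeat_triple)
  then show "bij_betw mset3 (repeat_triple D ` (V \<times> V))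
      {M. set_mset M \<subseteq> V \<and> size M = 3 \<and> card (set_mset M) \<noteq> 3}"
    by (auto simp: bij_betw_def image_comp intro: inj_on_imageI)
  show "inj_on (repeat_triple D) (V \<times> V)"
    using b by (auto simp: bij_betw_def intro: inj_on_imageI2)
qed

text \<open>A 3-multiset without repetition is determined by its support, so the bijection with
  3-subsets lifts along \<open>set_mset\<close>.\<close>

lemma bij_betw_mset3_windows:
  assumes "ucycle_3subsets n a"
  shows "bij_betw mset3 (window a ` {..<length a})
    {M. set_mset M \<subseteq> {1..n} \<and> size M = 3 \<and> card (set_mset M) = 3}"
proof -
  have simple: "M = mset_set (set_mset M)" if "size M = 3" "card (set_mset M) = 3" for M :: "nat multiset"
    using that by (elim size_3E) (auto simp: card_insert_if split: if_splits)
  have set_mset3: "set_mset (mset3 (window a i)) = {cyc_nth a i, cyc_nth a (i + 1), cyc_nth a (i + 2)}" for i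
    by (simp add: mset3_def window_def)
  have size_mset3: "size (mset3 t) = 3" for t by (simp add: mset3_def split: prod.splits)
  note b = bij_betw_window_sets[OF assms]
  let ?S = "{S. S \<subseteq> {1..n} \<and> card S = 3}"
  let ?M = "{M. set_mset M \<subseteq> {1..n} \<and> size M = 3 \<and> card (set_mset M) = 3}"
  have "bij_betw (set_mset \<circ> (mset3 \<circ> window a)) {..<length a} ?S"
    using b by (simp add: comp_def set_mset3)
  moreover have "bij_betw set_mset ?M ?S"
  proof (rule bij_betw_imageI)
    show "inj_on set_mset ?M"
      using simple by (intro inj_onI) (metis (mono_tags, lifting) mem_Collect_eq)
    show "set_mset ` ?M = ?S"
    proof (intro equalityI subsetI)
      fix S assume S: "S \<in> ?S"
      then have "finite S" using card.infinite by fastforce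
      with S show "S \<in> set_mset ` ?M"
        by (intro image_eqI[of _ _ "mset_set S"]) auto
    qed auto
  qed
  moreover have "(mset3 \<circ> window a) ` {..<length a} \<subseteq> ?M"
    using bij_betwE[OF b] by (auto simp: set_mset3 size_mset3)
  ultimately have "bij_betw (mset3 \<circ> window a) {..<length a} ?M"
    using bij_betw_comp_iff2 by blast
  then show ?thesis
    by (auto simp: bij_betw_def image_comp intro: inj_on_imageI)
qed

section \<open>Assembling the universal cycle for 3-multisets\<close>

text \<open>Pascal's rule, and two consecutive triangular numbers add up to a square. The term
  \<open>n * n\<close> counts the pairs that index \<open>repeat_triple\<close>.\<close>

lemma choose_3_add_2: "(n + 2) choose 3 = (n choose 3) + n * n"
proof -
  have "(n + 2) choose 3 = (n choose 3) + (n choose 2) + (Suc n choose 2)"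
    by (simp add: eval_nat_numeral)
  moreover have "(n choose 2) + (Suc n choose 2) = n * n"
    by (induction n) (simp_all add: numeral_2_eq_2)
  ultimately show ?thesis by simp
qed

lemma ucycle_3multisets_exists:
  assumes U: "ucycle_3subsets n a"
  shows "\<exists>b. ucycle_3multisets n b"
proof -
  let ?V = "{1..n}" and ?f = "cyc_nth a"
  obtain D i0
  where bo: "balanced_orientation ?V D"
    and adj: "\<forall>x\<in>?V. \<forall>y\<in>?V. x \<noteq> y \<longrightarrow> \<not> D x y \<longrightarrow> \<not> D y x \<longrightarrow> (\<exists>i. {?f i, ?f (i + 1)} = {x, y})"
    and dense: "\<forall>x\<in>?V. \<forall>y\<in>?V. \<forall>z\<in>?V. x \<noteq> y \<longrightarrow> x \<noteq> z \<longrightarrow> y \<noteq> z \<longrightarrow>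
       D x y \<or> D y x \<or> D x z \<or> D z x"
    and i0: "D (?f i0) (?f (i0 + 1))"
    by (rule balanced_orientation_ucycle[OF U]) (rule that)
  have D: "x \<in> ?V \<and> y \<in> ?V \<and> x \<noteq> y \<and> \<not> D y x" if "D x y" for x y
    using bo that unfolding balanced_orientation_def by blast
  define W where "W = window a ` {..<length a}"
  define R where "R = repeat_triple D ` (?V \<times> ?V)"
  let ?M = "{M. set_mset M \<subseteq> ?V \<and> size M = 3}"
  let ?MW = "{M. set_mset M \<subseteq> ?V \<and> size M = 3 \<and> card (set_mset M) = 3}"
  let ?MR = "{M. set_mset M \<subseteq> ?V \<and> size M = 3 \<and> card (set_mset M) \<noteq> 3}"
  note R_iff = repeat_triples_iff[OF bo, folded R_def]
  have bW: "bij_betw mset3 W ?MW" unfolding W_def by (rule bij_betw_mset3_windows[OF U])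
  have bR: "bij_betw mset3 R ?MR" unfolding R_def by (rule bij_betw_mset3_repeat_triples)
  have disj: "W \<inter> R = {}" using bij_betwE[OF bW] bij_betwE[OF bR] by blast
  have fin: "finite W" "finite R" by (simp_all add: W_def R_def)
  have "bij_betw mset3 (W \<union> R) (?MW \<union> ?MR)"
    by (rule bij_betw_combine[OF bW bR]) auto
  moreover have "?MW \<union> ?MR = ?M" by auto
  ultimately have bT: "bij_betw mset3 (W \<union> R) ?M" by simp
  have "card W = n choose 3"
    using card_image[OF inj_on_window[OF U]] length_ucycle[OF U] by (simp add: W_def)
  moreover have "card R = n * n"
    using card_image[OF inj_on_repeat_triple[of D ?V]] by (simp add: R_def card_cartesian_product)
  ultimately have cardT: "card (W \<union> R) = (n + 2) choose 3"
    using card_Un_disjoint[OF fin disj] by (simp only: choose_3_add_2)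
  have W_mem: "(?f i, ?f (i + 1), ?f (i + 2)) \<in> W" for i
  proof -
    have "window a i = window a (i mod length a)" by (simp add: window_mod)
    then have "window a i \<in> W" using length_ucycle(2)[OF U] by (simp add: W_def)
    then show ?thesis by (simp add: window_def)
  qed
  have T_range: "W \<union> R \<subseteq> ?V \<times> ?V \<times> ?V"
  proof
    fix t assume "t \<in> W \<union> R"
    then have "set_mset (mset3 t) \<subseteq> ?V" using bij_betwE[OF bT] by blast
    then show "t \<in> ?V \<times> ?V \<times> ?V" by (cases t) (simp add: mset3_def)
  qed
  \<comment> \<open>The pair at positions 0 and 1 is a common reference: every pair that starts a
    triple is compared with it.\<close>
  have connected: "P x y \<longleftrightarrow> P (?f 0) (?f 1)"
    if P: "\<And>x y z. (x, y, z) \<in> W \<union> R \<Longrightarrow> P x y \<longleftrightarrow> P y z" and t: "(x, y, z) \<in> W \<union> R" for P x y z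
  proof -
    have onW: "P (?f i) (?f (i + 1)) \<longleftrightarrow> P (?f 0) (?f 1)" for i
    proof (induction i)
      case (Suc i)
      then show ?case using P[OF UnI1[OF W_mem[of i]]] by simp
    qed simp
    have onD: "P u u \<longleftrightarrow> P u v" "P u v \<longleftrightarrow> P v v" if "D u v" for u v
      using that P[of u u v] P[of u v v] R_iff by blast+
    have unrel: "P u v \<longleftrightarrow> P v u" if "u \<in> ?V" "v \<in> ?V" "\<not> D u v" "\<not> D v u" for u v
      using that P[of u v u] R_iff by blast
    have diag: "P u u \<longleftrightarrow> P v v" if uv: "u \<in> ?V" "v \<in> ?V" for u v
    proof (cases "u = v \<or> D u v \<or> D v u")
      case True
      then show ?thesis using onD[of u v] onD[of v u] by auto
    next
      case False
      \<comment> \<open>Since \<open>u\<close> and \<open>v\<close> are unjoined,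
        \<open>dense\<close> joins both to any third vertex \<open>w\<close>, and \<open>P\<close>
        passes through \<open>(w, w)\<close>.\<close>
      have "\<not> ?V \<subseteq> {u, v}"
      proof
        assume "?V \<subseteq> {u, v}"
        from card_mono[OF _ this] have "n \<le> card {u, v}" by simp
        then show False using ucycle_size_ge_4[OF U] card_insert_le_m1[of 2 "{v}" u] by simp
      qed
      then obtain w where w: "w \<in> ?V" "w \<noteq> u" "w \<noteq> v" by blast
      then have "D u w \<or> D w u" "D v w \<or> D w v"
        using False dense[rule_format, of u v w] dense[rule_format, of v u w] uv by auto
      then show ?thesis using onD[of u w] onD[of w u] onD[of v w] onD[of w v] by blast
    qed
    \<comment> \<open>The arc at \<open>i0\<close> is where the diagonal pairs meet the
      windows.\<close>
    have loop: "P u u \<longleftrightarrow> P (?f 0) (?f 1)" if "u \<in> ?V" for u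
      using diag[OF that, of "?f i0"] D[OF i0] onD[OF i0] onW[of i0] by simp
    have related: "P u v \<longleftrightarrow> P (?f 0) (?f 1)" if "u = v \<or> D u v" "u \<in> ?V" for u v
      using that onD(1)[of u v] loop[of u] by auto
    have unrelated: "P u v \<longleftrightarrow> P (?f 0) (?f 1)"
      if uv: "u \<in> ?V" "v \<in> ?V" "u \<noteq> v" "\<not> D u v" "\<not> D v u" for u v
    proof -
      \<comment> \<open>The sequence may list the pair in either order; the 2-cycle through
        \<open>(u, v)\<close> and \<open>(v, u)\<close> makes the orders equivalent.\<close>
      obtain i where "{?f i, ?f (i + 1)} = {u, v}" using adj uv by blast
      then have "?f i = u \<and> ?f (i + 1) = v \<or> ?f i = v \<and> ?f (i + 1) = u"
        by (simp only: doubleton_eq_iff)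
      then show ?thesis using onW[of i] unrel[of u v] uv by auto
    qed
    from t show ?thesis
    proof
      assume "(x, y, z) \<in> W"
      then obtain i where "x = ?f i" "y = ?f (i + 1)" by (auto simp: W_def window_def)
      then show ?thesis using onW by blast
    next
      assume "(x, y, z) \<in> R"
      \<comment> \<open>No triple of \<open>R\<close> starts with a pair \<open>(x, y)\<close> such
        that \<open>D y x\<close>, so these cases are exhaustive.\<close>
      then show ?thesis unfolding R_iff
        using related[of x y] unrelated[of x y] D[of x y] D[of y z] by blast
    qed
  qed
  obtain b where b: "length b = card (W \<union> R)" "bij_betw (window b) {..<length b} (W \<union> R)"
  proof (rule cyclic_sequence_of_balanced_triples[of "W \<union> R"])
    show "finite (W \<union> R)" using fin by simp
    show "W \<union> R \<noteq> {}" using W_mem by blast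
    show "card {z. (x, y, z) \<in> W \<union> R} = card {w. (w, x, y) \<in> W \<union> R}" for x y
    proof -
      \<comment> \<open>Degrees add over the disjoint sets \<open>W\<close> and \<open>R\<close>;
        \<open>h\<close> inserts the free coordinate at the end or at the front.\<close>
      have split: "card {z. h z \<in> W \<union> R} = card {z. h z \<in> W} + card {z. h z \<in> R}"
        if "inj h" for h :: "nat \<Rightarrow> nat \<times> nat \<times> nat"
      proof -
        have "finite {z. h z \<in> W}" "finite {z. h z \<in> R}"
          using finite_vimageI[OF fin(1) that] finite_vimageI[OF fin(2) that] by (simp_all add: vimage_def)
        moreover have "{z. h z \<in> W} \<inter> {z. h z \<in> R} = {}" using disj by blast
        moreover have "{z. h z \<in> W \<union> R} = {z. h z \<in> W} \<union> {z. h z \<in> R}" by blast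
        ultimately show ?thesis by (simp add: card_Un_disjoint)
      qed
      show ?thesis
        using split[of "\<lambda>z. (x, y, z)"] split[of "\<lambda>w. (w, x, y)"]
          balanced_windows[OF U, of x y] balanced_repeat_triples[OF _ bo, of x y]
        by (simp add: inj_def W_def R_def)
    qed
    show "P x' y'"
      if "\<And>x y z. (x, y, z) \<in> W \<union> R \<Longrightarrow> P x y \<longleftrightarrow> P y z"
        "(x, y, z) \<in> W \<union> R" "(x', y', z') \<in> W \<union> R" "P x y" for P x y z x' y' z'
      using connected[of P, OF that(1) that(2)] connected[of P, OF that(1) that(3)] that(4) by blast
  qed (rule that)
  have len: "length b = (n + 2) choose 3" using b(1) cardT by simp
  have bij: "bij_betw (mset3 \<circ> window b) {..<length b} ?M"
    using bij_betw_trans[OF b(2) bT] .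
  have "set b \<subseteq> ?V"
  proof
    fix x assume "x \<in> set b"
    then obtain i where i: "i < length b" "x = b ! i" by (auto simp: in_set_conv_nth)
    then have "fst (window b i) = x" by (simp add: window_def cyc_nth_def)
    moreover have "window b i \<in> ?V \<times> ?V \<times> ?V"
      using bij_betwE[OF b(2)] T_range i by blast
    ultimately show "x \<in> ?V" by (auto simp: mem_Times_iff)
  qed
  moreover have "\<exists>!i. i < length b \<and> {#cyc_nth b i, cyc_nth b (i + 1), cyc_nth b (i + 2)#} = M"
    if "set_mset M \<subseteq> ?V \<and> size M = 3" for M
  proof -
    have "M \<in> (mset3 \<circ> window b) ` {..<length b}"
      using that bij_betw_imp_surj_on[OF bij] by simp
    then obtain i where i: "i < length b" "mset3 (window b i) = M" by auto
    moreover have "j = i" if "j < length b" "mset3 (window b j) = M" for j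
      using inj_onD[OF bij_betw_imp_inj_on[OF bij], of j i] that i by simp
    ultimately have "\<exists>!i. i < length b \<and> mset3 (window b i) = M" by blast
    then show ?thesis by (simp add: mset3_def window_def)
  qed
  moreover have "(n + 2) choose 3 \<ge> 1" using ucycle_size_ge_4[OF U] by (simp add: Suc_le_eq)
  ultimately have "ucycle_3multisets n b"
    using len by (auto simp: ucycle_3multisets_def cyclic_seq_def)
  then show ?thesis ..
qed

theorem theorem9:
  fixes n :: nat
  assumes "n \<ge> 1"
  shows "(\<exists>convert :: nat list \<Rightarrow> nat list.
            \<forall>a. ucycle_3subsets n a \<longrightarrow> ucycle_3multisets n (convert a))
       \<and> ((\<exists>a. ucycle_3subsets n a) \<longrightarrow> (\<exists>b. ucycle_3multisets n b))"
proof (intro conjI impI)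
  show "\<exists>convert. \<forall>a. ucycle_3subsets n a \<longrightarrow> ucycle_3multisets n (convert a)"
    \<comment> \<open>Choice turns the existence of a result for each \<open>a\<close> into a
      function; on lists that are not universal cycles any value will do.\<close>
    by (intro choice allI) (use ucycle_3multisets_exists in blast)
qed (use ucycle_3multisets_exists in blast)

end
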